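(* Let $A$ be a finite local ring with unit group $U(A)$, and let $n \geq 1$. Then \[r_{n}(A)=\frac{|A|^{n}-\sum_{u \in U(A)} w_{n+2}^{u}(A)}{|A\setminus U(A)|}.\] Moreover, if $n$ is odd, then $r_{n}(A)=\dfrac{|A|^{n}-|U(A)|\,w_{n+2}^{1_{A}}(A)}{|A\setminus U(A)|}$.
   Context: For a commutative unitary ring $A$, the continuants are defined by $K_{-1}:=0_A$, $K_0:=1_A$, and for $i\ge1$, $K_i(X_1,\dots,X_i)$ is the determinant of the $i\times i$ tridiagonal matrix with diagonal $X_1,\dots,X_i$ and all entries on the sub- and super-diagonal equal to $1_A$; equivalently $K_n(X_1,\dots,X_n)=X_nK_{n-1}(X_1,\dots,X_{n-1})-K_{n-2}(X_1,\dots,X_{n-2})$. For $a\in A$, $R_{n}^{a}(A):=\{(a_{1},\ldots,a_{n}) \in A^{n} : K_{n}(a_{1},\ldots,a_{n})=a\}$ and $r_{n}(A):=|R_{n}^{0_{A}}(A)|$ (the number of roots of the $n$-th continuant). Set $M_{n}(a_1,\ldots,a_n):=\begin{pmatrix} a_{n} & -1_{A} \\ 1_{A} & 0_{A}\end{pmatrix}\cdots\begin{pmatrix} a_{1} & -1_{A} \\ 1_{A} & 0_{A}\end{pmatrix}$, and for $u\in U(A)$ let $w_{n}^{u}(A)$ be the number of $(a_1,\dots,a_n)\in A^n$ with $M_n(a_1,\dots,a_n)=\begin{pmatrix} u & 0_A\\ 0_A & u^{-1}\end{pmatrix}$. *)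

theory Defs
  imports "HOL-Library.Cardinality" "HOL-Algebra.Algebraic_Closure_Type" "Jordan_Normal_Form.Determinant"
begin

text \<open>
  The ring A is the type \<open>'a :: comm_ring_1\<close>, and an n-tuple over A is a list of length n: the
  entry written \<open>a_i\<close> (with i counted from 1) is \<open>as ! (i - 1)\<close>.
\<close>

definition local_ring :: "'a::comm_ring_1 itself \<Rightarrow> bool" where
  "local_ring _ \<longleftrightarrow> (\<exists>!\<mm>. maximalideal \<mm> (ring_of_type_algebra :: 'a ring))"

definition unit_group :: "'a::comm_ring_1 set" where
  "unit_group = {u. u dvd 1}"

definition unit_inv :: "'a::comm_ring_1 \<Rightarrow> 'a" where
  "unit_inv u = (THE v. u * v = 1)"

definition tuples :: "nat \<Rightarrow> 'a list set" where
  "tuples n = {as. length as = n}"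

text \<open>
  The length of the list is the index of the continuant. The empty list gives the determinant of the
  0 by 0 matrix, which is 1. The conventional value 0 at index -1 has no counterpart here.
\<close>

definition continuant :: "'a::comm_ring_1 list \<Rightarrow> 'a" where
  "continuant as = det (mat (length as) (length as)
     (\<lambda>(i, j). if i = j then as ! i else if i = Suc j \<or> j = Suc i then 1 else 0))"

definition continuant_fibre :: "nat \<Rightarrow> 'a::comm_ring_1 \<Rightarrow> 'a list set" where
  "continuant_fibre n a = {as \<in> tuples n. continuant as = a}"

definition num_roots :: "'a::comm_ring_1 itself \<Rightarrow> nat \<Rightarrow> nat" where
  "num_roots _ n = card (continuant_fibre n (0::'a))"

text \<open>The factor belonging to the first entry of the list is the rightmost one.\<close>

fun cont_mat :: "'a::comm_ring_1 list \<Rightarrow> 'a mat" where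
  "cont_mat [] = 1\<^sub>m 2"
| "cont_mat (a # as) = cont_mat as * mat_of_rows_list 2 [[a, - 1], [1, 0]]"

definition num_diag :: "nat \<Rightarrow> 'a::comm_ring_1 \<Rightarrow> nat" where
  "num_diag n u =
     card {as \<in> tuples n. cont_mat as = mat_of_rows_list 2 [[u, 0], [0, unit_inv u]]}"

end

theory Submission
  imports Defs
begin

text \<open>
  The first row of \<open>M_n(a_1, \<dots>, a_n)\<close> is \<open>(K_n(a_1, \<dots>, a_n), -K_{n-1}(a_2, \<dots>, a_n))\<close>, and its
  determinant is 1; so in a local ring, if \<open>K_n(a_1, \<dots>, a_n)\<close> is not a unit, then
  \<open>K_{n-1}(a_2, \<dots>, a_n)\<close> is one. In that case \<open>K_n\<close> is an affine bijection in \<open>a_1\<close>, hence all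
  non-units have equally large fibres under \<open>K_n\<close>. On the other hand, completing an n-tuple on both
  sides so that the matrix \<open>M_{n+2}\<close> becomes \<open>diag(u, u\<^sup>-\<^sup>1)\<close> is possible, and then in a unique way,
  exactly when \<open>K_n = -u\<^sup>-\<^sup>1\<close>. Summing the sizes of all fibres gives \<open>|A|^n\<close>. For odd n,
  multiplying the entries alternately by \<open>\<lambda>\<close> and \<open>\<lambda>\<^sup>-\<^sup>1\<close> multiplies \<open>K_n\<close> by \<open>\<lambda>\<close>, so that
  the fibres over units also have the same size.
\<close>

section \<open>Units\<close>

lemma unit_cancel:
  fixes p :: "'a::comm_ring_1"
  assumes "p dvd 1" "a * p = b * p"
  shows "a = b"
proof -
  obtain v where v: "p * v = 1" using assms(1) by (metis dvdE)
  have "a * p * v = b * p * v" by (simp only: assms(2))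
  then show ?thesis by (simp add: mult.assoc v)
qed

lemma unit_inv_unique:
  fixes u :: "'a::comm_ring_1"
  assumes "u * v = 1"
  shows "unit_inv u = v"
  unfolding unit_inv_def
proof (rule the_equality)
  show "u * v = 1" by (rule assms)
next
  fix w assume "u * w = 1"
  then have "w * u = v * u" using assms by (simp only: mult.commute)
  with dvdI[OF assms[symmetric]] show "w = v" by (rule unit_cancel)
qed

lemma unit_inv_right:
  fixes u :: "'a::comm_ring_1"
  assumes "u dvd 1"
  shows "u * unit_inv u = 1"
proof -
  obtain v where "u * v = 1" using assms by (metis dvdE)
  then show ?thesis using unit_inv_unique by metis
qed

text \<open>Each non-unit lies in a maximal ideal. As there is only one such ideal, both summands
  lie in it, hence so does their sum, and a proper ideal contains no unit.\<close>

lemma local_ring_nonunit_add: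
  fixes x y :: "'a::{comm_ring_1, finite}"
  assumes loc: "local_ring TYPE('a)" and x: "\<not> x dvd 1" and y: "\<not> y dvd 1"
  shows "\<not> x + y dvd 1"
proof -
  define R where "R = (ring_of_type_algebra :: 'a ring)"
  interpret R: cring R unfolding R_def by (rule cring_from_type_algebra)
  have R: "carrier R = UNIV" "\<And>a b. a \<otimes>\<^bsub>R\<^esub> b = a * b" "\<And>a b. a \<oplus>\<^bsub>R\<^esub> b = a + b" "\<one>\<^bsub>R\<^esub> = 1"
    by (auto simp: R_def ring_of_type_algebra_def)
  have in_max: "\<exists>M. maximalideal M R \<and> z \<in> M" if z: "\<not> z dvd 1" for z
  proof -
    \<comment> \<open>The principal ideal of \<open>z\<close> shows that \<open>?S\<close> is
      non-empty; finiteness then gives a maximal member. An ideal above that member either omits 1,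
      so it is in \<open>?S\<close>, or is the whole ring.\<close>
    let ?S = "{J. ideal J R \<and> z \<in> J \<and> 1 \<notin> J}"
    have "ideal (PIdl\<^bsub>R\<^esub> z) R" "z \<in> PIdl\<^bsub>R\<^esub> z"
      by (auto intro: R.cgenideal_ideal R.cgenideal_self simp: R)
    moreover have "1 \<notin> PIdl\<^bsub>R\<^esub> z"
      using z by (auto simp: cgenideal_def R dvd_def mult.commute)
    ultimately have "PIdl\<^bsub>R\<^esub> z \<in> ?S" by simp
    then obtain M where M: "M \<in> ?S" and max: "\<And>J. J \<in> ?S \<Longrightarrow> M \<subseteq> J \<Longrightarrow> J = M"
      using finite_has_maximal[of ?S] by (metis (no_types, lifting) empty_iff finite)
    have "maximalideal M R"
    proof (rule maximalidealI)
      fix J assume J: "ideal J R" "M \<subseteq> J"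
      show "J = M \<or> J = carrier R"
        using max[of J] J M ideal.one_imp_carrier[OF J(1)] by (auto simp: R)
    qed (use M R in auto)
    with M show ?thesis by blast
  qed
  obtain M where M: "maximalideal M R" "x \<in> M" "y \<in> M"
    using in_max[OF x] in_max[OF y] loc unfolding local_ring_def R_def by metis
  then interpret M: maximalideal M R by simp
  have "x + y \<in> M" using M.a_closed[OF M(2,3)] by (simp add: R)
  moreover have "z \<notin> M" if "z dvd 1" for z
  proof
    assume "z \<in> M"
    then have "z * unit_inv z \<in> M" using M.I_r_closed[of z "unit_inv z"] by (simp add: R)
    then show False
      using M.one_imp_carrier M.I_notcarr by (simp add: R unit_inv_right[OF that])
  qed
  ultimately show ?thesis by blast
qed

section \<open>Continuants and two-by-two matrices\<close>

lemma mat22_mult: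
  fixes a :: "'a::comm_ring_1"
  shows "mat_of_rows_list 2 [[a, b], [c, d]] * mat_of_rows_list 2 [[a', b'], [c', d']] =
    mat_of_rows_list 2 [[a * a' + b * c', a * b' + b * d'], [c * a' + d * c', c * b' + d * d']]"
  by (rule eq_matI)
    (auto simp: mat_of_rows_list_def scalar_prod_def less_Suc_eq numeral_2_eq_2)

lemma mat22_eq_iff:
  "mat_of_rows_list 2 [[a, b], [c, d]] = mat_of_rows_list 2 [[a', b'], [c', d']] \<longleftrightarrow>
    a = a' \<and> b = b' \<and> c = c' \<and> d = d'"
  (is "?A = ?B \<longleftrightarrow> _")
proof
  assume "?A = ?B"
  then have "\<And>i j. ?A $$ (i, j) = ?B $$ (i, j)" by simp
  from this[of 0 0] this[of 0 1] this[of 1 0] this[of 1 1]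
  show "a = a' \<and> b = b' \<and> c = c' \<and> d = d'" by (simp add: mat_of_rows_list_def)
qed simp

lemma mat22_cases:
  assumes "A \<in> carrier_mat 2 2"
  shows "A = mat_of_rows_list 2 [[A $$ (0,0), A $$ (0,1)], [A $$ (1,0), A $$ (1,1)]]"
  using assms by (intro eq_matI) (auto simp: mat_of_rows_list_def less_Suc_eq numeral_2_eq_2)

lemma mat22_carrier: "mat_of_rows_list 2 [[a, b], [c, d]] \<in> carrier_mat 2 2"
  by (rule carrier_matI) (simp_all add: mat_of_rows_list_def)

lemma cont_mat_carrier: "cont_mat as \<in> carrier_mat 2 2"
proof (induction as)
  case Nil
  show ?case by simp
next
  case (Cons a as)
  show ?case unfolding cont_mat.simps by (rule mult_carrier_mat[OF Cons mat22_carrier])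
qed

lemma cont_mat_append: "cont_mat (as @ bs) = cont_mat bs * cont_mat as"
proof (induction as)
  case Nil
  show ?case by (simp add: right_mult_one_mat[OF cont_mat_carrier])
next
  case (Cons a as)
  show ?case
    unfolding append_Cons cont_mat.simps Cons
    by (rule assoc_mult_mat[OF cont_mat_carrier cont_mat_carrier mat22_carrier])
qed

lemma continuant_Nil: "continuant [] = 1"
  by (simp add: continuant_def)

lemma continuant_single: "continuant [a] = a"
  by (simp add: continuant_def det_single)

text \<open>Laplace expansion along the first column, whose only nonzero entries are
  \<open>a\<close> and 1, peels off the front of the list.\<close>

lemma continuant_Cons_Cons:
  "continuant (a # b # as) = a * continuant (b # as) - continuant as"
proof -
  define T :: "'a list \<Rightarrow> 'a mat" where "T = (\<lambda>as. mat (length as) (length as)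
     (\<lambda>(i, j). if i = j then as ! i else if i = Suc j \<or> j = Suc i then 1 else 0))"
  have cont: "continuant as = det (T as)" for as by (simp add: continuant_def T_def)
  let ?A = "T (a # b # as)" and ?n = "length as"
  let ?B = "mat_delete ?A 1 0"
  have A: "?A \<in> carrier_mat (Suc (Suc ?n)) (Suc (Suc ?n))" by (simp add: T_def)
  have B: "?B \<in> carrier_mat (Suc ?n) (Suc ?n)" using mat_delete_carrier[OF A] by simp
  have A00: "mat_delete ?A 0 0 = T (b # as)"
    by (rule eq_matI) (auto simp: T_def mat_delete_def)
  have B00: "mat_delete ?B 0 0 = T as"
    by (rule eq_matI) (auto simp: T_def mat_delete_def)
  \<comment> \<open>Row 0 of \<open>?B\<close> is (1, 0, ..., 0), so a single cofactor
    survives.\<close>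
  have "det ?B = (\<Sum>j<Suc ?n. ?B $$ (0, j) * cofactor ?B 0 j)"
    by (rule laplace_expansion_row[OF B]) simp
  also have "\<dots> = cofactor ?B 0 0"
    unfolding sum.lessThan_Suc_shift by (simp add: T_def mat_delete_def)
  finally have detB: "det ?B = continuant as" by (simp add: cofactor_def B00 cont del: One_nat_def)
  have "det ?A = (\<Sum>i<Suc (Suc ?n). ?A $$ (i, 0) * cofactor ?A i 0)"
    by (rule laplace_expansion_column[OF A]) simp
  also have "\<dots> = a * cofactor ?A 0 0 + cofactor ?A 1 0"
    unfolding sum.lessThan_Suc_shift by (simp add: T_def)
  also have "\<dots> = a * continuant (b # as) - continuant as"
    using detB by (simp add: cofactor_def A00 cont)
  finally show ?thesis by (simp add: cont)
qed

lemma cont_mat_Cons_entries: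
  "cont_mat (a # as) $$ (0, 0) = a * cont_mat as $$ (0, 0) + cont_mat as $$ (0, 1)"
  "cont_mat (a # as) $$ (0, 1) = - (cont_mat as $$ (0, 0))"
  "cont_mat (a # as) $$ (1, 0) = a * cont_mat as $$ (1, 0) + cont_mat as $$ (1, 1)"
  "cont_mat (a # as) $$ (1, 1) = - (cont_mat as $$ (1, 0))"
proof -
  have "cont_mat (a # as) = mat_of_rows_list 2
      [[cont_mat as $$ (0, 0), cont_mat as $$ (0, 1)], [cont_mat as $$ (1, 0), cont_mat as $$ (1, 1)]]
      * mat_of_rows_list 2 [[a, - 1], [1, 0]]"
    using mat22_cases[OF cont_mat_carrier, of as] by (metis cont_mat.simps(2))
  then have "cont_mat (a # as) = mat_of_rows_list 2
      [[a * cont_mat as $$ (0, 0) + cont_mat as $$ (0, 1), - (cont_mat as $$ (0, 0))],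
       [a * cont_mat as $$ (1, 0) + cont_mat as $$ (1, 1), - (cont_mat as $$ (1, 0))]]"
    unfolding mat22_mult by (simp add: mult.commute)
  then show "cont_mat (a # as) $$ (0, 0) = a * cont_mat as $$ (0, 0) + cont_mat as $$ (0, 1)"
    "cont_mat (a # as) $$ (0, 1) = - (cont_mat as $$ (0, 0))"
    "cont_mat (a # as) $$ (1, 0) = a * cont_mat as $$ (1, 0) + cont_mat as $$ (1, 1)"
    "cont_mat (a # as) $$ (1, 1) = - (cont_mat as $$ (1, 0))"
    by (simp_all add: mat_of_rows_list_def del: cont_mat.simps)
qed

text \<open>Entry (0, 1) is minus the (0, 0) entry of the shorter product, so the (0, 0) entries
  obey the continuant recursion; lengths 0 and 1 agree directly.\<close>

lemma continuant_eq_entry: "continuant as = cont_mat as $$ (0, 0)"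
proof (induction as rule: induct_list012)
  case (2 a)
  then show ?case by (subst cont_mat_Cons_entries(1)) (simp add: continuant_single)
next
  case (3 a b as)
  then show ?case
    by (subst cont_mat_Cons_entries(1), subst cont_mat_Cons_entries(2))
      (simp add: continuant_Cons_Cons del: cont_mat.simps)
qed (simp add: continuant_Nil)

text \<open>Shows the continuant as affine in its first entry. For empty \<open>as\<close> the
  constant term is 0, matching the convention K_{-1} = 0, so length 1 is no special case.\<close>

lemma continuant_Cons: "continuant (a # as) = a * continuant as + cont_mat as $$ (0, 1)"
  by (simp only: continuant_eq_entry cont_mat_Cons_entries)

text \<open>Every factor of the product has determinant 1.\<close>

lemma cont_mat_det:
  "cont_mat as $$ (0, 0) * cont_mat as $$ (1, 1) - cont_mat as $$ (0, 1) * cont_mat as $$ (1, 0) = 1"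
proof (induction as)
  case (Cons a as)
  then show ?case
    unfolding cont_mat_Cons_entries by (simp add: algebra_simps)
qed simp

text \<open>Determinant 1 is a Bezout identity for the two continuants; if both were non-units,
  locality would make 1 a non-unit.\<close>

lemma continuant_tl_unit:
  fixes as :: "'a::{comm_ring_1, finite} list"
  assumes "local_ring TYPE('a)" "\<not> continuant (a # as) dvd 1"
  shows "continuant as dvd 1"
proof (rule ccontr)
  assume nu: "\<not> continuant as dvd 1"
  define r s where "r = cont_mat (a # as) $$ (1, 0)" and "s = cont_mat (a # as) $$ (1, 1)"
  have "continuant (a # as) * s + continuant as * r = 1"
    using cont_mat_det[of "a # as"]
    unfolding r_def s_def continuant_eq_entry cont_mat_Cons_entries(2) by simp
  moreover have "\<not> continuant (a # as) * s dvd 1" "\<not> continuant as * r dvd 1"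
    using assms(2) nu dvd_mult_left by blast+
  ultimately show False using local_ring_nonunit_add[OF assms(1)] by (metis dvd_refl)
qed

section \<open>Counting\<close>

lemma finite_tuples [simp]: "finite (tuples n :: 'a::finite list set)"
  using finite_lists_length_eq[of "UNIV :: 'a set" n] by (simp add: tuples_def)

lemma card_tuples: "card (tuples n :: 'a::finite list set) = CARD('a) ^ n"
  using card_lists_length_eq[of "UNIV :: 'a set" n] by (simp add: tuples_def)

text \<open>Dropping the first entry is a bijection between the two sets. The right-hand side is
  free of \<open>x\<close>, which makes all non-unit fibres equally large.\<close>

lemma card_fibre_nonunit:
  fixes x :: "'a::{comm_ring_1, finite}"
  assumes loc: "local_ring TYPE('a)" and x: "\<not> x dvd 1"
  shows "card (continuant_fibre (Suc n) x) = card {as \<in> tuples n. continuant as dvd (1::'a)}"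
proof -
  have "bij_betw tl (continuant_fibre (Suc n) x) {as \<in> tuples n. continuant as dvd (1::'a)}"
    unfolding bij_betw_def
  proof (intro conjI equalityI subsetI)
    show "inj_on tl (continuant_fibre (Suc n) x)"
    proof (rule inj_onI)
      fix cs ds assume *: "cs \<in> continuant_fibre (Suc n) x" "ds \<in> continuant_fibre (Suc n) x"
        "tl cs = tl ds"
      then obtain c d as where cd: "cs = c # as" "ds = d # as"
        by (cases cs; cases ds) (auto simp: continuant_fibre_def tuples_def)
      with * have eq: "continuant (c # as) = x" "continuant (d # as) = x"
        by (auto simp: continuant_fibre_def)
      then have "continuant as dvd 1" using continuant_tl_unit[OF loc, of c as] x by simp
      moreover have "c * continuant as = d * continuant as"
        using eq unfolding continuant_Cons by (metis add_right_cancel)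
      ultimately show "cs = ds" using cd unit_cancel by metis
    qed
  next
    fix as assume "as \<in> tl ` continuant_fibre (Suc n) x"
    then obtain a where "length as = n" "continuant (a # as) = x"
      by (auto simp: continuant_fibre_def tuples_def length_Suc_conv)
    then show "as \<in> {as \<in> tuples n. continuant as dvd 1}"
      using continuant_tl_unit[OF loc, of a as] x by (simp add: tuples_def)
  next
    fix as :: "'a list" assume as: "as \<in> {as \<in> tuples n. continuant as dvd 1}"
    \<comment> \<open>The solution of the affine equation \<open>continuant (a # as) = x\<close> for
      \<open>a\<close>, whose slope is a unit.\<close>
    let ?a = "(x - cont_mat as $$ (0, 1)) * unit_inv (continuant as)"
    have "continuant as * unit_inv (continuant as) = 1" using as by (simp add: unit_inv_right)
    then have "continuant (?a # as) = x"
      by (simp add: continuant_Cons mult.assoc mult.commute[of "unit_inv _"])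
    then have "?a # as \<in> continuant_fibre (Suc n) x"
      using as by (simp add: continuant_fibre_def tuples_def)
    then show "as \<in> tl ` continuant_fibre (Suc n) x" by force
  qed
  then show ?thesis by (rule bij_betw_same_card)
qed

text \<open>The lower right entry makes \<open>continuant bs\<close> a unit, and the off-diagonal
  entries then fix \<open>a\<close> and \<open>c\<close>. The upper left entry agrees automatically,
  because the determinant is 1.\<close>

lemma cont_mat_extend_eq_diag_iff:
  fixes u :: "'a::comm_ring_1"
  assumes u: "u dvd 1"
  shows "cont_mat (a # bs @ [c]) = mat_of_rows_list 2 [[u, 0], [0, unit_inv u]] \<longleftrightarrow>
    continuant bs = - unit_inv u \<and> a = cont_mat bs $$ (0, 1) * u \<and> c = - (cont_mat bs $$ (1, 0) * u)"
    (is "?L \<longleftrightarrow> ?R")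
proof -
  define p q r s where pqrs: "p = cont_mat bs $$ (0, 0)" "q = cont_mat bs $$ (0, 1)"
    "r = cont_mat bs $$ (1, 0)" "s = cont_mat bs $$ (1, 1)"
  have det: "p * s - q * r = 1" using cont_mat_det[of bs] by (simp add: pqrs)
  define v where "v = unit_inv u"
  have uv: "u * v = 1" unfolding v_def by (rule unit_inv_right[OF u])
  have one: "cont_mat [c] = mat_of_rows_list 2 [[c, -1], [1, 0]]"
    by (simp add: left_mult_one_mat[OF mat22_carrier])
  have bs: "cont_mat bs = mat_of_rows_list 2 [[p, q], [r, s]]"
    using mat22_cases[OF cont_mat_carrier, of bs] by (simp add: pqrs)
  \<comment> \<open>The factor of the last list entry \<open>c\<close> stands leftmost, that of
    \<open>a\<close> rightmost.\<close>
  have "cont_mat (a # bs @ [c]) =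
      mat_of_rows_list 2 [[(c * p - r) * a + (c * q - s), - (c * p - r)], [p * a + q, - p]]"
    by (simp add: cont_mat_append one bs mat22_mult del: cont_mat.simps(1)) 
       (simp add: cont_mat_append one[simplified] bs mat22_mult)
  then have "?L \<longleftrightarrow> (c * p - r) * a + (c * q - s) = u \<and> - (c * p - r) = 0 \<and> p * a + q = 0 \<and> - p = v"
    by (simp only: mat22_eq_iff v_def)
  also have "\<dots> \<longleftrightarrow> p = - v \<and> a = q * u \<and> c = - (r * u)"
  proof (rule iffI)
    assume h: "(c * p - r) * a + (c * q - s) = u \<and> - (c * p - r) = 0 \<and> p * a + q = 0 \<and> - p = v"
    then have p: "p = - v" by (metis minus_minus)
    have "c * p = r" "p * a = - q" using h by (simp, metis add_eq_0_iff2)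
    then have cv: "c * v = - r" and va: "v * a = q"
      unfolding p by (metis minus_minus mult_minus_right, metis minus_equation_iff mult_minus_left)
    have "a = (v * a) * u" "c = (c * v) * u"
      using uv by (simp_all add: mult.commute mult.left_commute)
    then have "a = q * u" "c = - r * u" unfolding cv va .
    with p show "p = - v \<and> a = q * u \<and> c = - (r * u)" by simp
  next
    assume h: "p = - v \<and> a = q * u \<and> c = - (r * u)"
    have cp: "c * p - r = 0" using h uv by (simp add: algebra_simps)
    have pa: "p * a + q = 0" using h uv by (simp add: algebra_simps)
    \<comment> \<open>Since \<open>c * p - r\<close> vanishes, only this part of the upper left
      entry remains; the determinant relation eliminates \<open>q * r\<close>.\<close>
    have "c * q - s = - u * (q * r) - s" using h by (simp add: algebra_simps)
    also have "q * r = p * s - 1" using det by (simp add: algebra_simps)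
    also have "- u * (p * s - 1) - s = (u * v) * s + u - s" using h by (simp add: algebra_simps)
    finally have "c * q - s = u" using uv by simp
    with cp pa h show "(c * p - r) * a + (c * q - s) = u \<and> - (c * p - r) = 0 \<and> p * a + q = 0 \<and> - p = v"
      by simp
  qed
  finally show ?thesis by (simp add: pqrs v_def continuant_eq_entry)
qed

text \<open>Stripping both end entries is a bijection, since the middle block determines
  them.\<close>

lemma num_diag_eq_card_fibre:
  fixes u :: "'a::{comm_ring_1, finite}"
  assumes u: "u dvd 1"
  shows "num_diag (n + 2) u = card (continuant_fibre n (- unit_inv u))"
proof -
  let ?D = "{as \<in> tuples (n + 2). cont_mat as = mat_of_rows_list 2 [[u, 0], [0, unit_inv u]]}"
  let ?f = "\<lambda>bs. (cont_mat bs $$ (0, 1) * u) # bs @ [- (cont_mat bs $$ (1, 0) * u)]"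
  have inj: "inj_on ?f (continuant_fibre n (- unit_inv u))" by (rule inj_onI) simp
  have img: "?f ` continuant_fibre n (- unit_inv u) = ?D"
  proof (intro equalityI subsetI)
    fix as assume "as \<in> ?f ` continuant_fibre n (- unit_inv u)"
    then show "as \<in> ?D"
      using cont_mat_extend_eq_diag_iff[OF u]
      by (auto simp: continuant_fibre_def tuples_def simp del: cont_mat.simps)
  next
    fix as assume as: "as \<in> ?D"
    then obtain a cs where "as = a # cs" "length cs = Suc n"
      by (auto simp: tuples_def length_Suc_conv)
    then obtain bs c where abc: "as = a # bs @ [c]" "length bs = n"
      by (metis length_append_singleton length_0_conv nat.inject old.nat.distinct(1) rev_exhaust)
    with as cont_mat_extend_eq_diag_iff[OF u, of a bs c]
    show "as \<in> ?f ` continuant_fibre n (- unit_inv u)"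
      by (auto simp: continuant_fibre_def tuples_def simp del: cont_mat.simps)
  qed
  show ?thesis unfolding num_diag_def img[symmetric] by (rule card_image[OF inj])
qed

text \<open>Used with \<open>u * v = 1\<close>, so that the product of two neighbouring entries is
  unchanged; this symmetry links the fibres over different units.\<close>

fun alt_scale :: "'a::comm_ring_1 \<Rightarrow> 'a \<Rightarrow> 'a list \<Rightarrow> 'a list" where
  "alt_scale u v [] = []"
| "alt_scale u v (a # as) = u * a # alt_scale v u as"

lemma length_alt_scale [simp]: "length (alt_scale u v as) = length as"
  by (induction u v as rule: alt_scale.induct) auto

lemma alt_scale_inverse:
  assumes "u * v = 1"
  shows "alt_scale v u (alt_scale u v as) = as"
  using assms
proof (induction u v as rule: alt_scale.induct)
  case (2 u v a as)
  have vu: "v * u = 1" using 2(2) by (simp add: mult.commute)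
  then have "v * (u * a) = a" by (simp flip: mult.assoc)
  with 2(1)[OF vu] show ?case by simp
qed simp

text \<open>Both terms of the recursion pick up the same factor: 1 in even length, where
  \<open>u\<close> and \<open>v\<close> cancel in the first term, and \<open>u\<close> in odd
  length. The tail starts with \<open>v\<close>, so \<open>u\<close> and \<open>v\<close> vary in
  the induction.\<close>

lemma continuant_alt_scale:
  assumes "u * v = 1"
  shows "continuant (alt_scale u v as) = (if even (length as) then 1 else u) * continuant as"
  using assms
proof (induction as arbitrary: u v rule: induct_list012)
  case (3 a b as)
  have vu: "v * u = 1" using 3(3) by (simp add: mult.commute)
  have uv: "u * a * (v * k) = a * k" for k
  proof -
    have "u * a * (v * k) = (u * v) * (a * k)" by (simp only: ac_simps)
    then show ?thesis by (simp add: 3(3))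
  qed
  have "continuant (alt_scale u v (a # b # as)) =
      u * a * continuant (alt_scale v u (b # as)) - continuant (alt_scale u v as)"
    by (simp add: continuant_Cons_Cons)
  also have "\<dots> = u * a * ((if even (length (b # as)) then 1 else v) * continuant (b # as))
      - (if even (length as) then 1 else u) * continuant as"
    by (simp only: 3(2)[OF vu] 3(1)[OF 3(3)])
  also have "\<dots> = (if even (length as) then 1 else u) * (a * continuant (b # as) - continuant as)"
    by (cases "even (length as)") (simp_all add: right_diff_distrib mult.assoc uv[unfolded mult.assoc])
  finally show ?case by (simp add: continuant_Cons_Cons)
qed (simp_all add: continuant_Nil continuant_single)

text \<open>In odd length, alternate scaling carries one fibre onto the other, and scaling with the
  inverse undoes it.\<close>

lemma card_fibre_unit_mult:
  fixes u :: "'a::comm_ring_1"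
  assumes u: "u dvd 1" and n: "odd n"
  shows "card (continuant_fibre n (u * x)) = card (continuant_fibre n x)"
proof -
  define v where "v = unit_inv u"
  have uv: "u * v = 1" and vu: "v * u = 1"
    unfolding v_def using unit_inv_right[OF u] by (simp_all add: mult.commute)
  have "bij_betw (alt_scale u v) (continuant_fibre n x) (continuant_fibre n (u * x))"
    by (rule bij_betw_byWitness[where f' = "alt_scale v u"])
      (use n uv vu in \<open>auto simp: alt_scale_inverse continuant_fibre_def tuples_def
        continuant_alt_scale mult.assoc[symmetric]\<close>)
  from bij_betw_same_card[OF this] show ?thesis by (rule sym)
qed

lemma sum_card_fibres:
  "(\<Sum>x\<in>UNIV. card (continuant_fibre n (x::'a::{comm_ring_1, finite}))) = CARD('a) ^ n"
proof -
  have "finite (continuant_fibre n x)" for x :: 'a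
    unfolding continuant_fibre_def by (rule finite_subset[OF _ finite_tuples[of n]]) blast
  then have "card (\<Union>x\<in>UNIV. continuant_fibre n (x::'a)) =
      (\<Sum>x\<in>UNIV. card (continuant_fibre n (x::'a)))"
    by (intro card_UN_disjoint) (auto simp: continuant_fibre_def)
  moreover have "(\<Union>x\<in>UNIV. continuant_fibre n (x::'a)) = tuples n"
    by (auto simp: continuant_fibre_def)
  ultimately show ?thesis by (simp add: card_tuples)
qed

text \<open>The map sending \<open>u\<close> to \<open>- unit_inv u\<close> is an involution of the
  unit group, so it only permutes the summands.\<close>

lemma sum_num_diag:
  "(\<Sum>u\<in>(unit_group :: 'a::{comm_ring_1, finite} set). num_diag (n + 2) u) =
    (\<Sum>u\<in>(unit_group :: 'a set). card (continuant_fibre n u))"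
proof (rule sum.reindex_bij_witness[where i = "\<lambda>u. - unit_inv u" and j = "\<lambda>u. - unit_inv u"])
  fix u :: 'a assume "u \<in> unit_group"
  then have u: "u dvd 1" by (simp add: unit_group_def)
  \<comment> \<open>Gives both that \<open>- unit_inv u\<close> is a unit and that its inverse is
    \<open>- u\<close>.\<close>
  have *: "- unit_inv u * - u = 1" using unit_inv_right[OF u] by (simp add: mult.commute)
  show "- unit_inv (- unit_inv u) = u" "- unit_inv (- unit_inv u) = u"
    using unit_inv_unique[OF *] by simp_all
  show "- unit_inv u \<in> unit_group" "- unit_inv u \<in> unit_group"
    using * by (auto simp only: unit_group_def mem_Collect_eq intro: dvdI[OF sym])
  show "card (continuant_fibre n (- unit_inv u)) = num_diag (n + 2) u"
    by (rule num_diag_eq_card_fibre[OF u, symmetric])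
qed

theorem theorem1p2:
  fixes n :: nat
  assumes "local_ring TYPE('a::{comm_ring_1, finite})"
    and "n \<ge> 1"
  shows "real (num_roots TYPE('a) n) =
           (real CARD('a) ^ n - (\<Sum>u\<in>(unit_group :: 'a set). real (num_diag (n + 2) u)))
             / real (card (UNIV - (unit_group :: 'a set))) \<and>
         (odd n \<longrightarrow> real (num_roots TYPE('a) n) =
           (real CARD('a) ^ n - real (card (unit_group :: 'a set)) * real (num_diag (n + 2) (1::'a)))
             / real (card (UNIV - (unit_group :: 'a set))))"
proof -
  let ?U = "unit_group :: 'a set"
  obtain m where m: "n = Suc m" using assms(2) by (cases n) auto
  have nz: "\<not> (0::'a) dvd 1" by simp
  \<comment> \<open>The fibres over \<open>x\<close> and over the non-unit 0 are both compared with
    the same set of tuples of length \<open>m\<close>.\<close>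
  have fib: "card (continuant_fibre n x) = num_roots TYPE('a) n" if "x \<in> UNIV - ?U" for x :: 'a
    using that card_fibre_nonunit[OF assms(1), of x m] card_fibre_nonunit[OF assms(1) nz, of m]
    by (simp add: num_roots_def m unit_group_def)
  have "CARD('a) ^ n = (\<Sum>x\<in>UNIV - ?U. card (continuant_fibre n x)) + (\<Sum>x\<in>?U. card (continuant_fibre n x))"
    unfolding sum_card_fibres[symmetric] by (rule sum.subset_diff) auto
  also have "\<dots> = card (UNIV - ?U) * num_roots TYPE('a) n + (\<Sum>u\<in>?U. num_diag (n + 2) u)"
    by (simp add: fib sum_num_diag[simplified])
  finally have "real (CARD('a) ^ n) =
      real (card (UNIV - ?U) * num_roots TYPE('a) n + (\<Sum>u\<in>?U. num_diag (n + 2) u))"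
    by (rule arg_cong)
  then have eq: "real CARD('a) ^ n - (\<Sum>u\<in>?U. real (num_diag (n + 2) u)) =
      real (num_roots TYPE('a) n) * real (card (UNIV - ?U))"
    by (simp add: mult.commute)
  \<comment> \<open>The denominator is nonzero because 0 is a non-unit.\<close>
  have "0 \<in> UNIV - ?U" using nz by (simp add: unit_group_def)
  then have pos: "real (card (UNIV - ?U)) \<noteq> 0" by (metis card_eq_0_iff empty_iff finite of_nat_eq_0_iff)
  have first: "real (num_roots TYPE('a) n) =
      (real CARD('a) ^ n - (\<Sum>u\<in>?U. real (num_diag (n + 2) u))) / real (card (UNIV - ?U))"
    unfolding eq using pos by simp
  \<comment> \<open>The count for \<open>u\<close> is the fibre size over
    \<open>unit_inv u * - 1\<close>; for odd \<open>n\<close> this equals the fibre size over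
    \<open>- 1\<close>, which is the count for 1.\<close>
  have diag: "num_diag (n + 2) u = num_diag (n + 2) (1::'a)" if "odd n" "u \<in> ?U" for u
  proof -
    have u: "u dvd 1" using that(2) by (simp add: unit_group_def)
    have "unit_inv u dvd 1" using unit_inv_right[OF u] by (metis dvd_triv_right)
    then show ?thesis
      using card_fibre_unit_mult[OF _ that(1), of "unit_inv u" "- 1"]
      by (simp add: num_diag_eq_card_fibre[OF u, simplified]
          num_diag_eq_card_fibre[of 1, simplified] unit_inv_unique[of 1 1])
  qed
  show ?thesis using first diag by simp
qed

end
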